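(* Let $\mathcal{H}$ be a separable Hilbert space, let $\pi_i:\mathbb{F}_{n_i}^+\to B(\mathcal{H})$, $i\in\{1,\ldots,k\}$, be representations with commuting ranges and let $\sigma:\mathbb{F}_{n_1}^+\times\cdots\times\mathbb{F}_{n_k}^+\to B(\mathcal{H})$ be the direct product representation defined by $$\sigma(\alpha_1,\ldots,\alpha_k)=\pi_1(\alpha_1)\cdots\pi_k(\alpha_k),\qquad(\alpha_1,\ldots,\alpha_k)\in\mathbb{F}_{n_1}^+\times\cdots\times\mathbb{F}_{n_k}^+.$$ Then the following statements are equivalent: (i) There is an invertible operator $Y\in B(\mathcal{H})$ such that $Y^{-1}\sigma(\cdot)Y$ is the direct product of strictly row contractive representations, i.e. $Y^{-1}\pi_i(\cdot)Y$ is a strictly row contractive representation for each $i\in\{1,\ldots,k\}$. (ii) $r(\pi_i)<1$ for each $i\in\{1,\ldots,k\}$.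
   Context: $n_i\in\mathbb{N}=\{1,2,\ldots\}$, and $\mathbb{F}_{n_i}^+$ is the free monoid on $n_i$ generators $g_1^i,\ldots,g_{n_i}^i$ with identity $g_0^i$. A representation $\pi_i:\mathbb{F}_{n_i}^+\to B(\mathcal{H})$ is a monoid homomorphism with $\pi_i(g_0^i)=I$. "Commuting ranges" means that for $s\ne t$ every element of the range of $\pi_s$ commutes with every element of the range of $\pi_t$. $\pi_i$ is strictly row contractive if $\|[\pi_i(g_1^i)\cdots\pi_i(g_{n_i}^i)]\|<1$, as a row operator from $\mathcal{H}^{(n_i)}$ (direct sum of $n_i$ copies of $\mathcal{H}$) to $\mathcal{H}$. The spectral radius of $\pi_i$ is $r(\pi_i):=\lim_{s\to\infty}\|\Phi_i^s(I)\|^{1/2s}$, where $\Phi_i(X):=\sum_{j=1}^{n_i}\pi_i(g_j^i)X\pi_i(g_j^i)^*$ and $\Phi_i^s$ is the $s$-th iterate. *)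

theory Defs
  imports "HOL-Analysis.Analysis"
begin

section \<open>Complex Hilbert spaces\<close>

text \<open>
  The class extends the real structure of the library, so that the norm, the topology and the
  space of bounded operators are the library's own; the real inner product is the real part of
  the complex one. The complex inner product is linear in its first argument. The zero space is
  allowed, and separability is not part of the class.
\<close>

class complex_hilbert_space = real_inner + complete_space +
  fixes scaleC :: "complex \<Rightarrow> 'a \<Rightarrow> 'a"  (infixr \<open>*\<^sub>C\<close> 75)
    and cinner :: "'a \<Rightarrow> 'a \<Rightarrow> complex"
  assumes scaleC_add_right: "c *\<^sub>C (x + y) = c *\<^sub>C x + c *\<^sub>C y"
    and scaleC_add_left: "(c + d) *\<^sub>C x = c *\<^sub>C x + d *\<^sub>C x"
    and scaleC_scaleC: "c *\<^sub>C (d *\<^sub>C x) = (c * d) *\<^sub>C x"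
    and scaleR_scaleC: "r *\<^sub>R x = complex_of_real r *\<^sub>C x"
    and cinner_commute: "cinner x y = cnj (cinner y x)"
    and cinner_add_left: "cinner (x + y) z = cinner x z + cinner y z"
    and cinner_scaleC_left: "cinner (c *\<^sub>C x) y = c * cinner x y"
    and inner_eq_Re_cinner: "inner x y = Re (cinner x y)"

instantiation complex :: complex_hilbert_space
begin

definition scaleC_complex :: "complex \<Rightarrow> complex \<Rightarrow> complex"
  where "scaleC_complex c x = c * x"

definition cinner_complex :: "complex \<Rightarrow> complex \<Rightarrow> complex"
  where "cinner_complex x y = x * cnj y"

instance
  by standard
    (simp_all add: scaleC_complex_def cinner_complex_def inner_complex_def algebra_simps
      scaleR_conv_of_real)

end

definition separable_hilbert :: "'a::complex_hilbert_space itself \<Rightarrow> bool"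
  where "separable_hilbert _ \<longleftrightarrow> (\<exists>D :: 'a set. countable D \<and> closure D = UNIV)"


section \<open>Bounded operators\<close>

text \<open>
  \<open>'a \<Rightarrow>\<^sub>L 'a\<close> consists of the real-linear bounded operators; \<open>B(H)\<close> is the set of
  complex-linear ones. The operator norm does not depend on the scalar field.
\<close>

definition BH :: "('a::complex_hilbert_space \<Rightarrow>\<^sub>L 'a) set"
  where "BH = {A. \<forall>c x. blinfun_apply A (c *\<^sub>C x) = c *\<^sub>C blinfun_apply A x}"

definition cadjoint ::
    "('a::complex_hilbert_space \<Rightarrow>\<^sub>L 'a) \<Rightarrow> ('a \<Rightarrow>\<^sub>L 'a)"
  where "cadjoint A =
    (THE B. B \<in> BH \<and> (\<forall>x y. cinner (blinfun_apply A x) y = cinner x (blinfun_apply B y)))"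

definition is_inverse ::
    "('a::complex_hilbert_space \<Rightarrow>\<^sub>L 'a) \<Rightarrow> ('a \<Rightarrow>\<^sub>L 'a) \<Rightarrow> bool"
  where "is_inverse Y Z \<longleftrightarrow> Y o\<^sub>L Z = id_blinfun \<and> Z o\<^sub>L Y = id_blinfun"

definition direct_sum :: "nat \<Rightarrow> (nat \<Rightarrow> 'a::complex_hilbert_space) set"
  where "direct_sum n = (\<Pi>\<^sub>E j\<in>{1..n}. UNIV)"

definition direct_sum_norm :: "nat \<Rightarrow> (nat \<Rightarrow> 'a::complex_hilbert_space) \<Rightarrow> real"
  where "direct_sum_norm n x = L2_set (\<lambda>j. norm (x j)) {1..n}"

definition row_operator ::
    "nat \<Rightarrow> (nat \<Rightarrow> 'a::complex_hilbert_space \<Rightarrow>\<^sub>L 'a) \<Rightarrow> (nat \<Rightarrow> 'a) \<Rightarrow> 'a"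
  where "row_operator n T x = (\<Sum>j=1..n. blinfun_apply (T j) (x j))"

definition row_norm :: "nat \<Rightarrow> (nat \<Rightarrow> 'a::complex_hilbert_space \<Rightarrow>\<^sub>L 'a) \<Rightarrow> real"
  where "row_norm n T =
    (SUP x \<in> {x \<in> direct_sum n. direct_sum_norm n x \<le> 1}. norm (row_operator n T x))"


section \<open>Representations of free monoids\<close>

text \<open>
  The free monoid on \<open>n\<close> generators consists of the words over \<open>{1..n}\<close>, with concatenation
  and the empty word as identity; the \<open>j\<close>-th generator is the word \<open>[j]\<close>.
\<close>

definition free_monoid :: "nat \<Rightarrow> nat list set"
  where "free_monoid n = lists {1..n}"

definition representation ::
    "nat \<Rightarrow> (nat list \<Rightarrow> 'a::complex_hilbert_space \<Rightarrow>\<^sub>L 'a) \<Rightarrow> bool"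
  where "representation n \<pi> \<longleftrightarrow>
    \<pi> ` free_monoid n \<subseteq> BH \<and> \<pi> [] = id_blinfun \<and>
    (\<forall>v\<in>free_monoid n. \<forall>w\<in>free_monoid n. \<pi> (v @ w) = \<pi> v o\<^sub>L \<pi> w)"

definition commuting_ranges ::
    "nat \<Rightarrow> (nat \<Rightarrow> nat) \<Rightarrow>
      (nat \<Rightarrow> nat list \<Rightarrow> 'a::complex_hilbert_space \<Rightarrow>\<^sub>L 'a) \<Rightarrow> bool"
  where "commuting_ranges k n \<pi> \<longleftrightarrow>
    (\<forall>s\<in>{1..k}. \<forall>t\<in>{1..k}. s \<noteq> t \<longrightarrow>
      (\<forall>A\<in>\<pi> s ` free_monoid (n s). \<forall>B\<in>\<pi> t ` free_monoid (n t). A o\<^sub>L B = B o\<^sub>L A))"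

definition strictly_row_contractive ::
    "nat \<Rightarrow> (nat list \<Rightarrow> 'a::complex_hilbert_space \<Rightarrow>\<^sub>L 'a) \<Rightarrow> bool"
  where "strictly_row_contractive n \<pi> \<longleftrightarrow> row_norm n (\<lambda>j. \<pi> [j]) < 1"

definition product_monoid :: "nat \<Rightarrow> (nat \<Rightarrow> nat) \<Rightarrow> (nat \<Rightarrow> nat list) set"
  where "product_monoid k n = (\<Pi>\<^sub>E i\<in>{1..k}. free_monoid (n i))"

definition direct_product ::
    "nat \<Rightarrow> (nat \<Rightarrow> nat list \<Rightarrow> 'a::complex_hilbert_space \<Rightarrow>\<^sub>L 'a) \<Rightarrow>
      (nat \<Rightarrow> nat list) \<Rightarrow> ('a \<Rightarrow>\<^sub>L 'a)"
  where "direct_product k \<pi> \<alpha> =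
    foldr (o\<^sub>L) (map (\<lambda>i. \<pi> i (\<alpha> i)) [1..<Suc k]) id_blinfun"

definition cp_map ::
    "nat \<Rightarrow> (nat list \<Rightarrow> 'a::complex_hilbert_space \<Rightarrow>\<^sub>L 'a) \<Rightarrow>
      ('a \<Rightarrow>\<^sub>L 'a) \<Rightarrow> ('a \<Rightarrow>\<^sub>L 'a)"
  where "cp_map n \<pi> X = (\<Sum>j=1..n. \<pi> [j] o\<^sub>L X o\<^sub>L cadjoint (\<pi> [j]))"

text \<open>
  The limit exists for every representation, since \<open>s \<mapsto> \<parallel>\<Phi>\<^sup>s(I)\<parallel>\<close> is submultiplicative.
  The convention \<open>0 powr a = 0\<close> gives the intended value in the nilpotent case.
\<close>

definition spectral_radius ::
    "nat \<Rightarrow> (nat list \<Rightarrow> 'a::complex_hilbert_space \<Rightarrow>\<^sub>L 'a) \<Rightarrow> real"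
  where "spectral_radius n \<pi> =
    lim (\<lambda>s::nat. norm ((cp_map n \<pi> ^^ s) id_blinfun) powr (1 / (2 * real s)))"

end

theory Submission
  imports Defs
begin

text \<open>
  Write \<open>\<Phi>\<^sub>i\<close> for the completely positive map of \<open>\<pi>\<^sub>i\<close>. By Fekete's lemma \<open>r(\<pi>\<^sub>i) < 1\<close> means that
  \<open>\<parallel>\<Phi>\<^sub>i\<^sup>s(I)\<parallel> < 1\<close> for some \<open>s \<ge> 1\<close>. With \<open>P = Y Y\<^sup>*\<close>, a strict row contraction \<open>Y\<^sup>-\<^sup>1 \<pi>\<^sub>i Y\<close>
  amounts to \<open>\<Phi>\<^sub>i(P) \<le> c\<^sup>2 P\<close> with \<open>c < 1\<close>, so \<open>\<Phi>\<^sub>i\<^sup>s(I)\<close> decays like \<open>c\<^sup>2\<^sup>s\<close>. Conversely,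
  since the \<open>\<Phi>\<^sub>i\<close> commute, the finite sum \<open>P\<close> of all \<open>\<Phi>\<^sub>1\<^sup>s \<dots> \<Phi>\<^sub>k\<^sup>t (I)\<close> with exponents below
  suitable bounds satisfies \<open>\<Phi>\<^sub>i(P) \<le> P - \<delta> I\<close> for every \<open>i\<close>, and \<open>Y = P\<^sup>1\<^sup>/\<^sup>2\<close> works for all
  \<open>i\<close> at once.
\<close>

section \<open>Adjoints\<close>

instance complex_hilbert_space \<subseteq> banach ..

text \<open>The representing vector minimises \<open>J x = \<parallel>x\<parallel>\<^sup>2 / 2 - f x\<close>; minimising sequences are Cauchy by the
  parallelogram law.\<close>

lemma riesz_representation:
  fixes f :: "'a::{real_inner,banach} \<Rightarrow> real"
  assumes "bounded_linear f"
  obtains z where "\<And>x. f x = inner x z"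
proof -
  interpret f: bounded_linear f by fact
  define J where "J x = inner x x / 2 - f x" for x
  obtain K where K: "\<And>x. \<bar>f x\<bar> \<le> norm x * K" and "K \<ge> 0"
    using f.nonneg_bounded by (auto simp: mult.commute)
  have lb: "- (K\<^sup>2 / 2) \<le> J x" for x
  proof -
    have "0 \<le> (norm x - K)\<^sup>2 / 2" by simp
    also have "\<dots> = inner x x / 2 - norm x * K + K\<^sup>2 / 2"
      by (simp add: power2_diff power2_norm_eq_inner field_simps)
    finally show ?thesis using K[of x] by (simp add: J_def)
  qed
  define m where "m = (INF x. J x)"
  have bdd: "bdd_below (range J)" using lb by (auto intro!: bdd_belowI)
  have m_le: "m \<le> J x" for x unfolding m_def using bdd by (simp add: cINF_lower)
  have "\<exists>x. J x < m + 1 / real (Suc k)" for k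
    using cINF_less_iff[of UNIV J "m + 1 / real (Suc k)"] bdd by (auto simp: m_def)
  then obtain X where X: "\<And>k. J (X k) < m + 1 / real (Suc k)" by metis
  have par: "(norm (x - y))\<^sup>2 = 4 * (J x + J y - 2 * J ((1/2) *\<^sub>R (x + y)))" for x y
    unfolding J_def power2_norm_eq_inner
    by (simp add: f.add f.scaleR inner_add inner_diff inner_commute field_simps)
  have close: "(norm (X i - X j))\<^sup>2 \<le> 8 / real (Suc k)" if "k \<le> i" "k \<le> j" for i j k
  proof -
    have "1 / real (Suc i) \<le> 1 / real (Suc k)" "1 / real (Suc j) \<le> 1 / real (Suc k)"
      using that by (auto simp: frac_le)
    then show ?thesis unfolding par
      using X[of i] X[of j] m_le[of "(1/2) *\<^sub>R (X i + X j)"] by simp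
  qed
  have "Cauchy X"
  proof (rule metric_CauchyI)
    fix e :: real assume "e > 0"
    obtain k where k: "8 / e\<^sup>2 < real (Suc k)"
      by (meson less_Suc_eq less_trans of_nat_less_iff reals_Archimedean2)
    have "8 / real (Suc k) < e\<^sup>2" using k \<open>e > 0\<close> by (simp add: field_simps)
    then have "dist (X i) (X j) < e" if "k \<le> i" "k \<le> j" for i j
      using close[OF that] \<open>e > 0\<close> unfolding dist_norm
      by (meson less_eq_real_def order_le_less_trans power2_less_imp_less)
    then show "\<exists>M. \<forall>m\<ge>M. \<forall>n\<ge>M. dist (X m) (X n) < e" by blast
  qed
  then obtain z where z: "X \<longlonglongrightarrow> z" by (auto simp: Cauchy_convergent_iff convergent_def)
  have "(\<lambda>k. J (X k)) \<longlonglongrightarrow> J z" unfolding J_def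
    by (intro tendsto_intros z f.tendsto) auto
  moreover have "(\<lambda>k. m + 1 / real (Suc k)) \<longlonglongrightarrow> m + 0"
    by (intro tendsto_intros LIMSEQ_Suc[OF lim_1_over_n])
  ultimately have Jz: "J z \<le> m"
    by (metis (no_types, lifting) LIMSEQ_le X add.right_neutral less_imp_le)
  have "f x = inner x z" for x
  proof (rule ccontr)
    assume ne: "f x \<noteq> inner x z"
    define d where "d = inner x z - f x"
    \<comment> \<open>First variation: \<open>z\<close> minimises \<open>J\<close> along every line
      \<open>z + t x\<close>, so this quadratic in \<open>t\<close> is nonnegative; its vertex
      \<open>t = - (d / inner x x)\<close> is where a nonzero \<open>d\<close> gives a
      contradiction.\<close>
    have quad: "0 \<le> t * d + t\<^sup>2 * inner x x / 2" for t
    proof -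
      have "J (z + t *\<^sub>R x) = J z + (t * d + t\<^sup>2 * inner x x / 2)"
        by (simp add: J_def d_def f.add f.scaleR inner_add inner_commute power2_eq_square field_simps)
      then show ?thesis using Jz m_le[of "z + t *\<^sub>R x"] by linarith
    qed
    have "x \<noteq> 0" using ne by (auto simp: f.zero)
    then have pos: "inner x x > 0" by simp
    have "d \<noteq> 0" using ne by (simp add: d_def)
    have "- (d / inner x x) * d + (- (d / inner x x))\<^sup>2 * inner x x / 2 = - (d\<^sup>2 / (2 * inner x x))"
      using pos by (simp add: power2_eq_square field_simps)
    then show False using quad[of "- (d / inner x x)"] pos \<open>d \<noteq> 0\<close>
      by (smt (verit) divide_pos_pos zero_less_power2)
  qed
  then show ?thesis by (rule that)
qed

text \<open>The adjoint for the real inner product exists for every bounded real-linear operator, so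
  its algebra carries no side conditions. On \<open>BH\<close> it coincides with
  \<open>cadjoint\<close>, see \<open>cadjoint_eq_adj\<close>.\<close>

definition adj :: "('a::{real_inner,banach} \<Rightarrow>\<^sub>L 'a) \<Rightarrow> 'a \<Rightarrow>\<^sub>L 'a"
  where "adj A = (THE B. \<forall>x y. inner (blinfun_apply A x) y = inner x (blinfun_apply B y))"

lemma adj_eqI:
  assumes "\<And>x y. inner (blinfun_apply A x) y = inner x (blinfun_apply B y)"
  shows "adj A = B"
  unfolding adj_def
proof (rule the_equality)
  fix C assume C: "\<forall>x y. inner (blinfun_apply A x) y = inner x (blinfun_apply C y)"
  show "C = B"
  proof (rule blinfun_eqI)
    fix y
    have "\<forall>x. inner x (blinfun_apply C y) = inner x (blinfun_apply B y)"
      using C by (simp flip: assms)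
    then show "blinfun_apply C y = blinfun_apply B y"
      by (simp only: vector_eq_ldot)
  qed
qed (use assms in simp)

text \<open>Riesz gives for each \<open>y\<close> a vector \<open>g y\<close> representing the
  functional on the left. Uniqueness of that vector makes \<open>g\<close> linear, and testing the
  identity at \<open>g y\<close> itself bounds \<open>g\<close> by \<open>norm A\<close>.\<close>

lemma inner_adj:
  "inner (blinfun_apply A x) y = inner x (blinfun_apply (adj A) y)"
proof -
  have bl: "bounded_linear (\<lambda>x. inner (blinfun_apply A x) y)" for y
    by (intro bounded_linear_intros)
  have "\<exists>z. \<forall>x. inner (blinfun_apply A x) y = inner x z" for y
    using riesz_representation[OF bl[of y]] by metis
  then obtain g where g: "\<And>x y. inner (blinfun_apply A x) y = inner x (g y)" by metis
  have "bounded_linear g"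
  proof (rule bounded_linear_intro)
    show "g (x + y) = g x + g y" for x y
      by (rule vector_eq_ldot[THEN iffD1]) (simp add: inner_add_right flip: g)
    show "g (r *\<^sub>R x) = r *\<^sub>R g x" for r x
      by (rule vector_eq_ldot[THEN iffD1]) (simp flip: g)
    show "norm (g x) \<le> norm x * norm A" for x
    proof (cases "g x = 0")
      case False
      have "norm (g x) * norm (g x) = inner (blinfun_apply A (g x)) x"
        by (simp add: g power2_norm_eq_inner flip: power2_eq_square)
      also have "\<dots> \<le> norm (blinfun_apply A (g x)) * norm x"
        by (rule norm_cauchy_schwarz)
      also have "\<dots> \<le> norm A * norm (g x) * norm x"
        by (intro mult_right_mono norm_blinfun) simp
      finally show ?thesis using False by (simp add: mult_ac)
    qed simp
  qed
  then have "adj A = Blinfun g"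
    by (intro adj_eqI) (simp add: g bounded_linear_Blinfun_apply)
  then show ?thesis by (simp add: g bounded_linear_Blinfun_apply \<open>bounded_linear g\<close>)
qed

lemma inner_adj': "inner (blinfun_apply (adj A) x) y = inner x (blinfun_apply A y)"
  by (metis inner_adj inner_commute)

lemma adj_adj [simp]: "adj (adj A) = A"
  by (rule adj_eqI) (simp add: inner_adj')

lemma adj_id [simp]: "adj id_blinfun = id_blinfun"
  by (rule adj_eqI) simp

lemma adj_compose: "adj (A o\<^sub>L B) = adj B o\<^sub>L adj A"
  by (rule adj_eqI) (simp add: inner_adj)

lemma adj_add: "adj (A + B) = adj A + adj B"
  by (rule adj_eqI) (simp add: inner_adj inner_add blinfun.add_left)

lemma adj_diff: "adj (A - B) = adj A - adj B"
  by (rule adj_eqI) (simp add: inner_adj inner_diff blinfun.diff_left)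

lemma adj_scaleR: "adj (r *\<^sub>R A) = r *\<^sub>R adj A"
  by (rule adj_eqI) (simp add: inner_adj blinfun.scaleR_left)

lemma adj_sum: "adj (sum f I) = (\<Sum>i\<in>I. adj (f i))"
  by (rule adj_eqI) (simp add: inner_adj inner_sum_left inner_sum_right blinfun.sum_left)

lemma norm_adj_le: "norm (adj A) \<le> norm A"
proof (rule norm_blinfun_bound)
  fix x
  let ?g = "blinfun_apply (adj A) x"
  show "norm ?g \<le> norm A * norm x"
  proof (cases "?g = 0")
    case False
    have "norm ?g * norm ?g = inner (blinfun_apply A ?g) x"
      by (simp add: inner_adj power2_norm_eq_inner flip: power2_eq_square)
    also have "\<dots> \<le> norm (blinfun_apply A ?g) * norm x"
      by (rule norm_cauchy_schwarz)
    also have "\<dots> \<le> norm A * norm ?g * norm x"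
      by (intro mult_right_mono norm_blinfun) simp
    finally show ?thesis using False by (simp add: mult_ac)
  qed simp
qed simp

text \<open>Polarisation and the parallelogram law bound \<open>inner (A u) v\<close> by
  \<open>M\<close> for unit vectors; taking \<open>v\<close> in the direction of \<open>A u\<close>
  gives the norm. This converts bounds on quadratic forms of iterates into norm bounds.\<close>

lemma norm_selfadjoint_le:
  fixes A :: "'a::{real_inner,banach} \<Rightarrow>\<^sub>L 'a"
  assumes sa: "adj A = A" and "M \<ge> 0"
    and b: "\<And>x. \<bar>inner (blinfun_apply A x) x\<bar> \<le> M * (norm x)\<^sup>2"
  shows "norm A \<le> M"
proof (rule norm_blinfun_bound)
  fix x
  let ?y = "blinfun_apply A x"
  show "norm ?y \<le> M * norm x"
  proof (cases "?y = 0 \<or> x = 0")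
    case False
    then have pos: "norm ?y > 0" "norm x > 0" by auto
    define u v where "u = x /\<^sub>R norm x" and "v = ?y /\<^sub>R norm ?y"
    have nuv: "norm u = 1" "norm v = 1" using pos by (auto simp: u_def v_def)
    have sym: "inner (blinfun_apply A v) u = inner (blinfun_apply A u) v"
      by (metis inner_adj inner_commute sa)
    have "4 * inner (blinfun_apply A u) v =
        inner (blinfun_apply A (u + v)) (u + v) - inner (blinfun_apply A (u - v)) (u - v)"
      by (simp add: blinfun.add_right blinfun.diff_right inner_add inner_diff sym)
    also have "\<dots> \<le> M * (norm (u + v))\<^sup>2 + M * (norm (u - v))\<^sup>2"
      using b[of "u + v"] b[of "u - v"] by linarith
    also have "\<dots> = M * (2 * (norm u)\<^sup>2 + 2 * (norm v)\<^sup>2)"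
      unfolding power2_norm_eq_inner
      by (simp add: inner_add inner_diff inner_commute algebra_simps)
    finally have "inner (blinfun_apply A u) v \<le> M" by (simp add: nuv)
    moreover have "inner (blinfun_apply A u) v = norm ?y / norm x"
      using pos by (simp add: u_def v_def blinfun.scaleR_right power2_eq_square field_simps
        flip: power2_norm_eq_inner)
    ultimately show ?thesis using pos by (simp add: field_simps)
  qed (use \<open>M \<ge> 0\<close> in auto)
qed fact

section \<open>Complex-linear operators and the complex adjoint\<close>

lemma inner_scaleC_left:
  "inner (c *\<^sub>C x) y = inner x (cnj c *\<^sub>C (y::'a::complex_hilbert_space))"
  by (metis cinner_commute cinner_scaleC_left complex_cnj_mult complex_cnj_cnj inner_eq_Re_cinner)

text \<open>In this form complex linearity passes to \<open>adj\<close> by swapping the sides of the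
  inner product, and it is visibly a closed condition on \<open>A\<close>.\<close>

lemma BH_iff_inner:
  "A \<in> BH \<longleftrightarrow> (\<forall>c x y. inner (blinfun_apply A (c *\<^sub>C x)) y = inner (blinfun_apply A x) (cnj c *\<^sub>C y))"
  unfolding BH_def by (simp add: vector_eq_rdot flip: inner_scaleC_left) 

lemma adj_BH: "A \<in> BH \<Longrightarrow> adj A \<in> BH"
  unfolding BH_iff_inner
  by (metis inner_adj inner_commute complex_cnj_cnj)

lemma scaleR_scaleC_commute: "r *\<^sub>R (c *\<^sub>C x) = c *\<^sub>C (r *\<^sub>R (x::'a::complex_hilbert_space))"
  by (simp add: scaleR_scaleC scaleC_scaleC mult.commute)

lemma id_BH: "id_blinfun \<in> BH" and
  compose_BH: "A \<in> BH \<Longrightarrow> B \<in> BH \<Longrightarrow> A o\<^sub>L B \<in> BH" and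
  add_BH: "A \<in> BH \<Longrightarrow> B \<in> BH \<Longrightarrow> A + B \<in> BH" and
  scaleR_BH: "A \<in> BH \<Longrightarrow> r *\<^sub>R A \<in> BH"
  by (simp_all add: BH_def blinfun.add_left blinfun.scaleR_left scaleC_add_right scaleR_scaleC_commute)

lemma diff_BH: "A \<in> BH \<Longrightarrow> B \<in> BH \<Longrightarrow> A - B \<in> BH"
  using add_BH[of A "(-1) *\<^sub>R B"] scaleR_BH[of B "-1"] by simp

lemma zero_BH: "0 \<in> BH"
  using scaleR_BH[OF id_BH, of 0] by simp

lemma sum_BH: "(\<And>i. i \<in> I \<Longrightarrow> f i \<in> BH) \<Longrightarrow> sum f I \<in> BH"
  by (induction I rule: infinite_finite_induct) (auto intro: zero_BH add_BH)

text \<open>Recovers the imaginary part from the real inner product, so that once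
  \<open>adj A\<close> is known to be complex-linear, the real adjoint identity yields the complex
  one.\<close>

lemma cinner_eq_inner: "cinner x y = Complex (inner x y) (inner x (\<i> *\<^sub>C y))"
proof -
  have "inner x (\<i> *\<^sub>C y) = Re (cnj (\<i> * cnj (cinner x y)))"
    by (metis inner_eq_Re_cinner cinner_commute cinner_scaleC_left)
  then show ?thesis by (simp add: complex_eq_iff inner_eq_Re_cinner)
qed

lemma cadjoint_eq_adj:
  assumes "A \<in> BH" shows "cadjoint A = adj A"
  unfolding cadjoint_def
proof (rule the_equality)
  have "blinfun_apply (adj A) (\<i> *\<^sub>C y) = \<i> *\<^sub>C blinfun_apply (adj A) y" for y
    using adj_BH[OF assms] by (simp add: BH_def)
  then show "adj A \<in> BH \<and> (\<forall>x y. cinner (blinfun_apply A x) y = cinner x (blinfun_apply (adj A) y))"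
    by (simp add: adj_BH[OF assms] cinner_eq_inner inner_adj)
  show "B = adj A" if "B \<in> BH \<and> (\<forall>x y. cinner (blinfun_apply A x) y = cinner x (blinfun_apply B y))" for B
    by (rule adj_eqI[symmetric]) (simp add: that inner_eq_Re_cinner)
qed

lemma bounded_linear_adj: "bounded_linear adj"
  by (rule bounded_linear_intro[where K = 1]) (simp_all add: adj_add adj_scaleR norm_adj_le)

text \<open>Needed for completeness of the set on which the square root is found as a fixed
  point.\<close>

lemma closed_BH: "closed (BH :: ('a::complex_hilbert_space \<Rightarrow>\<^sub>L 'a) set)"
proof -
  have "BH = (\<Inter>c. \<Inter>x. \<Inter>y. {A :: 'a \<Rightarrow>\<^sub>L 'a.
      inner (blinfun_apply A (c *\<^sub>C x)) y = inner (blinfun_apply A x) (cnj c *\<^sub>C y)})"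
    by (auto simp: BH_iff_inner)
  also have "closed \<dots>"
    by (intro closed_INT ballI closed_Collect_eq continuous_intros)
  finally show ?thesis .
qed

section \<open>Inverses and square roots\<close>

lemma blinfun_compose_algebra:
  "(A + B) o\<^sub>L C = (A o\<^sub>L C) + (B o\<^sub>L C)" "A o\<^sub>L (B' + C') = (A o\<^sub>L B') + (A o\<^sub>L C')"
  "(A - B) o\<^sub>L C = (A o\<^sub>L C) - (B o\<^sub>L C)" "A o\<^sub>L (B' - C') = (A o\<^sub>L B') - (A o\<^sub>L C')"
  "(r *\<^sub>R A) o\<^sub>L C = r *\<^sub>R (A o\<^sub>L C)" "A o\<^sub>L (r *\<^sub>R C) = r *\<^sub>R (A o\<^sub>L C)"
  "(sum f I) o\<^sub>L C = (\<Sum>i\<in>I. f i o\<^sub>L C)" "A o\<^sub>L (sum g I) = (\<Sum>i\<in>I. A o\<^sub>L g i)"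
  "id_blinfun o\<^sub>L C = C" "A o\<^sub>L id_blinfun = A"
  "(A o\<^sub>L C) o\<^sub>L D = A o\<^sub>L (C o\<^sub>L D)"
  by (auto intro!: blinfun_eqI simp: blinfun.bilinear_simps blinfun.sum_left blinfun.sum_right)

text \<open>Instead of summing the Neumann series, a right and a left inverse are obtained as fixed
  points of the contractions \<open>W \<mapsto> I + B W\<close> and
  \<open>V \<mapsto> I + V B\<close>; associativity makes them equal.\<close>

lemma neumann_inverse:
  fixes B :: "'a::banach \<Rightarrow>\<^sub>L 'a"
  assumes "norm B < 1"
  obtains W where "(id_blinfun - B) o\<^sub>L W = id_blinfun" "W o\<^sub>L (id_blinfun - B) = id_blinfun"
proof -
  have "\<exists>!W. id_blinfun + (B o\<^sub>L W) = W"
  proof (rule banach_fix_type[where c = "norm B"]; (intro allI)?)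
    fix X Y :: "'a \<Rightarrow>\<^sub>L 'a"
    have "dist (id_blinfun + (B o\<^sub>L X)) (id_blinfun + (B o\<^sub>L Y)) = norm (B o\<^sub>L (X - Y))"
      by (simp add: dist_norm blinfun_compose_algebra)
    also have "\<dots> \<le> norm B * dist X Y" unfolding dist_norm by (rule norm_blinfun_compose)
    finally show "dist (id_blinfun + (B o\<^sub>L X)) (id_blinfun + (B o\<^sub>L Y)) \<le> norm B * dist X Y" .
  qed (use assms in auto)
  then obtain W where W: "id_blinfun + (B o\<^sub>L W) = W" by blast
  have "\<exists>!V. id_blinfun + (V o\<^sub>L B) = V"
  proof (rule banach_fix_type[where c = "norm B"]; (intro allI)?)
    fix X Y :: "'a \<Rightarrow>\<^sub>L 'a"
    have "dist (id_blinfun + (X o\<^sub>L B)) (id_blinfun + (Y o\<^sub>L B)) = norm ((X - Y) o\<^sub>L B)"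
      by (simp add: dist_norm blinfun_compose_algebra)
    also have "\<dots> \<le> norm B * dist X Y" unfolding dist_norm
      by (metis norm_blinfun_compose mult.commute)
    finally show "dist (id_blinfun + (X o\<^sub>L B)) (id_blinfun + (Y o\<^sub>L B)) \<le> norm B * dist X Y" .
  qed (use assms in auto)
  then obtain V where V: "id_blinfun + (V o\<^sub>L B) = V" by blast
  have 1: "(id_blinfun - B) o\<^sub>L W = id_blinfun"
    using W by (simp add: blinfun_compose_algebra diff_eq_eq)
  have 2: "V o\<^sub>L (id_blinfun - B) = id_blinfun"
    using V by (simp add: blinfun_compose_algebra diff_eq_eq)
  have "V = V o\<^sub>L ((id_blinfun - B) o\<^sub>L W)" by (simp only: 1 blinfun_compose_algebra(10))
  also have "\<dots> = W" by (simp only: 2 blinfun_compose_algebra(9) flip: blinfun_compose_algebra(11))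
  finally show ?thesis using that[OF 1] 2 by simp
qed

lemma inverse_BH:
  assumes "Y \<in> BH" "is_inverse Y Z" shows "Z \<in> BH"
  unfolding BH_def
proof (intro CollectI allI)
  fix c x
  have YZ: "blinfun_apply Y (blinfun_apply Z u) = u" "blinfun_apply Z (blinfun_apply Y u) = u" for u
    using assms(2) unfolding is_inverse_def
    by (metis blinfun_apply_blinfun_compose blinfun_apply_id_blinfun id_apply)+
  have "blinfun_apply Z (c *\<^sub>C x) = blinfun_apply Z (c *\<^sub>C blinfun_apply Y (blinfun_apply Z x))"
    by (simp only: YZ)
  also have "\<dots> = blinfun_apply Z (blinfun_apply Y (c *\<^sub>C blinfun_apply Z x))"
    using assms(1) by (simp add: BH_def)
  also have "\<dots> = c *\<^sub>C blinfun_apply Z x"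
    by (rule YZ)
  finally show "blinfun_apply Z (c *\<^sub>C x) = c *\<^sub>C blinfun_apply Z x" .
qed

text \<open>With \<open>c\<close> large, \<open>A = I - P / c\<close> has norm below 1, and the contraction
  \<open>B \<mapsto> (A + B\<^sup>2) / 2\<close> has a fixed point, for which \<open>(I - B)\<^sup>2 = I - A = P / c\<close>.\<close>

lemma positive_definite_sqrt:
  fixes P :: "'a::complex_hilbert_space \<Rightarrow>\<^sub>L 'a"
  assumes P: "P \<in> BH" "adj P = P" and ge: "\<And>x. (norm x)\<^sup>2 \<le> inner (blinfun_apply P x) x"
  obtains Y Z where "Y \<in> BH" "Z \<in> BH" "is_inverse Y Z" "Y o\<^sub>L adj Y = P"
proof -
  \<comment> \<open>This choice gives both \<open>c \<ge> 1\<close>, so that \<open>a\<close> is a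
    real root in \<open>[0, 1)\<close>, and \<open>norm (P x)\<close> squared at most
    \<open>c\<close> times \<open>norm x\<close> squared. With \<open>P \<ge> I\<close> the latter
    yields \<open>norm A \<le> a\<close>.\<close>
  define c where "c = (norm P)\<^sup>2 + 1"
  define A where "A = id_blinfun - (1/c) *\<^sub>R P"
  define a where "a = sqrt (1 - 1/c)"
  have c: "c \<ge> 1" by (simp add: c_def)
  then have a: "0 \<le> a" "a < 1" "a\<^sup>2 = 1 - 1/c" by (auto simp: a_def)
  have normA: "norm A \<le> a"
  proof (rule norm_blinfun_bound)
    fix x
    let ?Px = "blinfun_apply P x"
    have "(norm ?Px)\<^sup>2 \<le> (norm P * norm x)\<^sup>2"
      by (intro power_mono norm_blinfun) simp
    also have "\<dots> \<le> c * (norm x)\<^sup>2"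
      by (simp add: c_def power_mult_distrib algebra_simps)
    finally have 1: "(norm ?Px)\<^sup>2 / c\<^sup>2 \<le> (norm x)\<^sup>2 / c"
      using c by (simp add: field_simps power2_eq_square)
    have "(norm (blinfun_apply A x))\<^sup>2 = (norm x)\<^sup>2 - 2 * (inner ?Px x / c) + (norm ?Px)\<^sup>2 / c\<^sup>2"
      unfolding power2_norm_eq_inner A_def
      by (simp add: blinfun.bilinear_simps inner_diff inner_commute power2_eq_square field_simps)
    also have "\<dots> \<le> (norm x)\<^sup>2 - 2 * ((norm x)\<^sup>2 / c) + (norm x)\<^sup>2 / c"
      using 1 divide_right_mono[OF ge[of x], of c] c by linarith
    also have "\<dots> = (a * norm x)\<^sup>2"
      unfolding power_mult_distrib a(3) by (simp add: left_diff_distrib)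
    finally show "norm (blinfun_apply A x) \<le> a * norm x"
      by (rule power2_le_imp_le) (use a in simp)
  qed fact
  have A: "A \<in> BH" "adj A = A"
    by (simp_all add: A_def diff_BH id_BH scaleR_BH P adj_diff adj_scaleR)
  \<comment> \<open>Self-adjointness and complex linearity are built into the complete set, so the
    fixed point inherits them.\<close>
  define S where "S = {B :: 'a \<Rightarrow>\<^sub>L 'a. norm B \<le> a \<and> adj B = B \<and> B \<in> BH}"
  define f where "f B = (1/2) *\<^sub>R (A + (B o\<^sub>L B))" for B
  have "closed S" unfolding S_def
    by (intro closed_Collect_conj closed_Collect_le closed_Collect_eq continuous_intros
        linear_continuous_on bounded_linear_adj) (simp add: closed_BH)
  have "\<exists>!B\<in>S. f B = B"
  proof (rule Banach_fix[where c = a])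
    show "complete S" using \<open>closed S\<close> by (simp add: complete_eq_closed)
    show "S \<noteq> {}" using normA A by (auto simp: S_def)
    show "f ` S \<subseteq> S"
    proof safe
      fix B assume "B \<in> S"
      then have B: "norm B \<le> a" "adj B = B" "B \<in> BH" by (auto simp: S_def)
      have "norm (B o\<^sub>L B) \<le> a * a"
        using norm_blinfun_compose[of B B] mult_mono[OF B(1) B(1)] a by simp
      also have "\<dots> \<le> a" using a by (simp add: mult_left_le)
      finally have "norm (f B) \<le> a"
        using normA norm_triangle_ineq[of A "B o\<^sub>L B"] by (simp add: f_def)
      then show "f B \<in> S"
        by (simp add: S_def f_def adj_scaleR adj_add adj_compose A B scaleR_BH add_BH compose_BH)
    qed
    fix B C assume "B \<in> S" "C \<in> S"
    then have BC: "norm B \<le> a" "norm C \<le> a" by (auto simp: S_def)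
    \<comment> \<open>A difference of squares split without commutativity: the mixed terms
      \<open>B C\<close> cancel.\<close>
    have "f B - f C = (1/2) *\<^sub>R ((B o\<^sub>L (B - C)) + ((B - C) o\<^sub>L C))"
      by (simp add: f_def blinfun_compose_algebra algebra_simps)
    also have "norm \<dots> \<le> (1/2) * (norm B * norm (B - C) + norm (B - C) * norm C)"
      using norm_triangle_ineq[of "B o\<^sub>L (B - C)" "(B - C) o\<^sub>L C"]
        norm_blinfun_compose[of B "B - C"] norm_blinfun_compose[of "B - C" C] by simp
    also have "\<dots> \<le> (1/2) * (a * norm (B - C) + norm (B - C) * a)"
      using BC by (intro mult_left_mono add_mono mult_right_mono) auto
    finally show "dist (f B) (f C) \<le> a * dist B C"
      by (simp add: dist_norm mult.commute)
  qed (use a in auto)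
  then obtain B where "B \<in> S" and fB: "f B = B" by blast
  then have B: "norm B \<le> a" "adj B = B" "B \<in> BH" by (auto simp: S_def)
  obtain W where W: "(id_blinfun - B) o\<^sub>L W = id_blinfun" "W o\<^sub>L (id_blinfun - B) = id_blinfun"
    using neumann_inverse[of B] B a by auto
  define Y where "Y = sqrt c *\<^sub>R (id_blinfun - B)"
  define Z where "Z = (1 / sqrt c) *\<^sub>R W"
  have Y: "Y \<in> BH" "adj Y = Y"
    by (simp_all add: Y_def scaleR_BH diff_BH id_BH B adj_scaleR adj_diff)
  have inv: "is_inverse Y Z"
    using W c by (simp add: is_inverse_def Y_def Z_def blinfun_compose_algebra(5,6))
  have "(B o\<^sub>L B) = 2 *\<^sub>R f B - A" by (simp add: f_def)
  then have BB: "(B o\<^sub>L B) = 2 *\<^sub>R B - A" by (simp add: fB)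
  have "Y o\<^sub>L Y = c *\<^sub>R (id_blinfun - 2 *\<^sub>R B + (B o\<^sub>L B))"
    using c by (simp add: Y_def blinfun_compose_algebra scaleR_2 algebra_simps)
  also have "\<dots> = P" using c by (simp add: BB A_def)
  finally show ?thesis
    using that[of Y Z] Y inv inverse_BH[OF Y(1) inv] by simp
qed

section \<open>Fekete's lemma\<close>

text \<open>Multiplicative form of Fekete's lemma. If the \<open>m\<close>-th root lies below
  \<open>r\<close>, division of \<open>s\<close> by \<open>m\<close> with remainder gives
  \<open>a s \<le> C * r ^ s\<close>, and the \<open>s\<close>-th root of \<open>C\<close> tends to
  1. Index 0 is excluded because \<open>1 / real 0 = 0\<close> makes its term no root at
  all.\<close>

lemma submultiplicative_root_tendsto:
  fixes a :: "nat \<Rightarrow> real"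
  assumes nn: "\<And>s. 0 \<le> a s" and sub: "\<And>s t. a (s + t) \<le> a s * a t"
  shows "(\<lambda>s. a s powr (1 / real s)) \<longlonglongrightarrow> (INF s\<in>{1..}. a s powr (1 / real s))"
    (is "?b \<longlonglongrightarrow> ?L")
proof (rule order_tendstoI)
  have bdd: "bdd_below (?b ` {1..})" by (auto intro!: bdd_belowI[of _ 0])
  have L_le: "?L \<le> ?b s" if "s \<ge> 1" for s
    using that by (intro cINF_lower bdd) auto
  have L0: "0 \<le> ?L" by (intro cINF_greatest) auto
  fix y
  { assume "y < ?L"
    then show "\<forall>\<^sub>F s in sequentially. y < ?b s"
      using L_le by (intro eventually_sequentiallyI[of 1]) force }
  assume y: "?L < y"
  define r where "r = (?L + y) / 2"
  have r: "?L < r" "r < y" "0 < r" using y L0 by (auto simp: r_def)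
  then obtain m where m: "m \<ge> 1" "?b m < r"
    using cINF_less_iff[OF _ bdd, of r] by auto
  \<comment> \<open>If \<open>a m = 0\<close>, both sides vanish because \<open>0 powr x = 0\<close>
    and \<open>m \<ge> 1\<close>; otherwise root and power cancel.\<close>
  have "a m = ?b m ^ m"
    using m nn[of m] by (cases "a m = 0") (simp_all add: powr_powr flip: powr_realpow)
  also have "\<dots> \<le> r ^ m" using m by (intro power_mono) auto
  finally have am: "a m \<le> r ^ m" .
  \<comment> \<open>The sum dominates all possible remainders \<open>k < m\<close>; the added 1
    keeps \<open>C\<close> positive, which makes \<open>C powr 0\<close> equal to 1 in the final
    limit.\<close>
  define C where "C = (\<Sum>k<m. a k / r ^ k) + 1"
  have C: "C > 0" using nn r by (auto simp: C_def intro!: add_nonneg_pos sum_nonneg)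
  have aC: "a k \<le> C * r ^ k" if "k < m" for k
  proof -
    have "a k / r ^ k \<le> (\<Sum>k<m. a k / r ^ k)"
      using that nn r by (intro member_le_sum) auto
    then have "a k / r ^ k \<le> C" by (simp add: C_def)
    then show ?thesis using r by (simp add: field_simps)
  qed
  have pow: "a (m * q + k) \<le> a m ^ q * a k" for q k
  proof (induction q)
    case (Suc q)
    have "a (m * Suc q + k) \<le> a m * a (m * q + k)"
      using sub[of m "m * q + k"] by (simp add: algebra_simps)
    also have "\<dots> \<le> a m * (a m ^ q * a k)"
      by (intro mult_left_mono Suc nn)
    finally show ?case by (simp add: mult_ac)
  qed simp
  have bound: "a s \<le> C * r ^ s" for s
  proof -
    have "a s = a (m * (s div m) + s mod m)" by simp
    also have "\<dots> \<le> a m ^ (s div m) * a (s mod m)" by (rule pow)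
    also have "\<dots> \<le> (r ^ m) ^ (s div m) * (C * r ^ (s mod m))"
      using m nn r by (intro mult_mono power_mono am aC) auto
    also have "\<dots> = C * r ^ (m * (s div m) + s mod m)"
      by (simp only: power_add power_mult mult_ac)
    finally show ?thesis by simp
  qed
  have b_le: "?b s \<le> C powr (1 / real s) * r" if "s \<ge> 1" for s
  proof -
    have "?b s \<le> (C * r ^ s) powr (1 / real s)"
      using that bound nn by (intro powr_mono2) auto
    also have "\<dots> = C powr (1 / real s) * r"
      using that C r by (simp add: powr_mult powr_powr flip: powr_realpow)
    finally show ?thesis .
  qed
  have "(\<lambda>s. C powr (1 / real s) * r) \<longlonglongrightarrow> C powr 0 * r"
    using C by (intro tendsto_intros lim_1_over_n) auto
  then have "\<forall>\<^sub>F s in sequentially. C powr (1 / real s) * r < y"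
    using C r by (intro order_tendstoD(2)) auto
  then show "\<forall>\<^sub>F s in sequentially. ?b s < y"
    using eventually_ge_at_top[of 1] by eventually_elim (use b_le in force)
qed

text \<open>The factor 2 in the exponent is absorbed by passing to \<open>sqrt (a s)\<close>, which
  is again submultiplicative. The limit is then an infimum, hence below 1 exactly when some term is,
  and taking roots does not change the side of 1.\<close>

lemma submultiplicative_lim_less_1_iff:
  fixes a :: "nat \<Rightarrow> real"
  assumes nn: "\<And>s. 0 \<le> a s" and sub: "\<And>s t. a (s + t) \<le> a s * a t"
  shows "lim (\<lambda>s. a s powr (1 / (2 * real s))) < 1 \<longleftrightarrow> (\<exists>s\<ge>1. a s < 1)"
proof -
  define b where "b s = sqrt (a s) powr (1 / real s)" for s
  have b: "a s powr (1 / (2 * real s)) = b s" for s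
    by (simp add: b_def nn powr_powr flip: powr_half_sqrt)
  have "b \<longlonglongrightarrow> (INF s\<in>{1..}. b s)"
    unfolding b_def
    by (rule submultiplicative_root_tendsto) (auto simp: nn sub simp flip: real_sqrt_mult)
  then have "lim (\<lambda>s. a s powr (1 / (2 * real s))) = (INF s\<in>{1..}. b s)"
    unfolding b by (rule limI)
  moreover have "(INF s\<in>{1..}. b s) < 1 \<longleftrightarrow> (\<exists>s\<in>{1..}. b s < 1)"
    by (intro cINF_less_iff bdd_belowI[of _ 0]) (auto simp: b_def)
  moreover have "b s < 1 \<longleftrightarrow> a s < 1" if "s \<ge> 1" for s
  proof
    show "b s < 1" if "a s < 1"
      using powr_less_mono2[of "1 / real s" "sqrt (a s)" 1] that \<open>s \<ge> 1\<close> nn[of s] by (simp add: b_def)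
    show "a s < 1" if "b s < 1"
      using ge_one_powr_ge_zero[of "sqrt (a s)" "1 / real s"] that by (force simp: b_def not_le[symmetric])
  qed
  ultimately show ?thesis by auto
qed

section \<open>Completely positive maps and row norms\<close>

text \<open>The Kraus form of \<open>cp_map\<close>, stated for a bare tuple of operators and with
  \<open>adj\<close>, so that its laws can be proved before representations enter.\<close>

definition kraus :: "nat \<Rightarrow> (nat \<Rightarrow> 'a::{real_inner,banach} \<Rightarrow>\<^sub>L 'a) \<Rightarrow> ('a \<Rightarrow>\<^sub>L 'a) \<Rightarrow> 'a \<Rightarrow>\<^sub>L 'a"
  where "kraus n T X = (\<Sum>j=1..n. T j o\<^sub>L X o\<^sub>L adj (T j))"

lemma inner_kraus:
  "inner (blinfun_apply (kraus n T X) x) y =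
    (\<Sum>j=1..n. inner (blinfun_apply X (blinfun_apply (adj (T j)) x)) (blinfun_apply (adj (T j)) y))"
  by (simp add: kraus_def blinfun.sum_left inner_sum_left inner_adj)

lemma kraus_diff: "kraus n T (X - Y) = kraus n T X - kraus n T Y"
  by (simp add: kraus_def blinfun_compose_algebra(3,4) sum_subtractf)

lemma kraus_sum: "kraus n T (sum f I) = (\<Sum>i\<in>I. kraus n T (f i))"
  unfolding kraus_def by (subst sum.swap) (simp add: blinfun_compose_algebra(7,8))

lemma adj_kraus: "adj (kraus n T X) = kraus n T (adj X)"
  by (simp add: kraus_def adj_sum adj_compose blinfun_compose_algebra(11))

lemma kraus_BH: "(\<And>j. j \<in> {1..n} \<Longrightarrow> T j \<in> BH) \<Longrightarrow> X \<in> BH \<Longrightarrow> kraus n T X \<in> BH"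
  unfolding kraus_def by (intro sum_BH compose_BH adj_BH)

text \<open>Each composite is a double sum over products \<open>T i S j\<close>, with the adjoint
  product on the right; commuting letters identify the summands after the sums are
  exchanged.\<close>

lemma kraus_commute:
  assumes "\<And>i j. i \<in> {1..n} \<Longrightarrow> j \<in> {1..m} \<Longrightarrow> T i o\<^sub>L S j = S j o\<^sub>L T i"
  shows "kraus n T (kraus m S X) = kraus m S (kraus n T X)"
proof -
  have "(T i o\<^sub>L (S j o\<^sub>L X o\<^sub>L adj (S j)) o\<^sub>L adj (T i)) = (S j o\<^sub>L (T i o\<^sub>L X o\<^sub>L adj (T i)) o\<^sub>L adj (S j))"
    if "i \<in> {1..n}" "j \<in> {1..m}" for i j
  proof -
    have "(T i o\<^sub>L (S j o\<^sub>L X o\<^sub>L adj (S j)) o\<^sub>L adj (T i)) = ((T i o\<^sub>L S j) o\<^sub>L X o\<^sub>L adj (T i o\<^sub>L S j))"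
      by (simp only: adj_compose blinfun_compose_algebra(11))
    also have "\<dots> = ((S j o\<^sub>L T i) o\<^sub>L X o\<^sub>L adj (S j o\<^sub>L T i))"
      by (simp only: assms[OF that])
    finally show ?thesis by (simp only: adj_compose blinfun_compose_algebra(11))
  qed
  then show ?thesis
    unfolding kraus_def blinfun_compose_algebra(7,8) by (subst sum.swap) (intro sum.cong refl)
qed

section \<open>Iterates, positivity and norm estimates\<close>

lemma kraus_funpow_diff: "(kraus n T ^^ s) (X - Y) = (kraus n T ^^ s) X - (kraus n T ^^ s) Y"
  by (induction s) (auto simp: kraus_diff)

lemma adj_kraus_funpow: "adj ((kraus n T ^^ s) X) = (kraus n T ^^ s) (adj X)"
  by (induction s) (auto simp: adj_kraus)

lemma kraus_funpow_BH:
  "(\<And>j. j \<in> {1..n} \<Longrightarrow> T j \<in> BH) \<Longrightarrow> X \<in> BH \<Longrightarrow> (kraus n T ^^ s) X \<in> BH"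
  by (induction s) (auto intro: kraus_BH)

lemma kraus_funpow_commute:
  assumes "\<And>i j. i \<in> {1..n} \<Longrightarrow> j \<in> {1..m} \<Longrightarrow> T i o\<^sub>L S j = S j o\<^sub>L T i"
  shows "kraus n T ((kraus m S ^^ s) X) = (kraus m S ^^ s) (kraus n T X)"
proof -
  have "kraus n T (kraus m S Y) = kraus m S (kraus n T Y)" for Y
    by (intro kraus_commute assms)
  then show ?thesis by (induction s) simp_all
qed

text \<open>By \<open>inner_kraus\<close> the form of the image is a sum of values of the original
  form at the vectors \<open>adj (T j) x\<close>. The absolute value encodes the two-sided order
  bound of \<open>X\<close> by \<open>r Q\<close>.\<close>

lemma kraus_dominated:
  assumes "\<And>x. \<bar>inner (blinfun_apply X x) x\<bar> \<le> r * inner (blinfun_apply Q x) x"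
  shows "\<bar>inner (blinfun_apply (kraus n T X) x) x\<bar> \<le> r * inner (blinfun_apply (kraus n T Q) x) x"
  unfolding inner_kraus sum_distrib_left by (rule order_trans[OF sum_abs]) (intro sum_mono assms)

lemma kraus_funpow_dominated:
  assumes "\<And>x. \<bar>inner (blinfun_apply X x) x\<bar> \<le> r * inner (blinfun_apply Q x) x"
  shows "\<bar>inner (blinfun_apply ((kraus n T ^^ s) X) x) x\<bar> \<le> r * inner (blinfun_apply ((kraus n T ^^ s) Q) x) x"
  by (induction s arbitrary: x) (auto simp: assms intro: kraus_dominated)

lemma kraus_funpow_nonneg:
  assumes "\<And>x. 0 \<le> inner (blinfun_apply X x) x"
  shows "0 \<le> inner (blinfun_apply ((kraus n T ^^ s) X) x) x"
  using kraus_funpow_dominated[where X = X and r = 1 and Q = X and n = n and T = T and s = s and x = x] assms by force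

lemma abs_quadratic_form_le: "\<bar>inner (blinfun_apply A x) x\<bar> \<le> norm A * (norm x)\<^sup>2"
proof -
  have "\<bar>inner (blinfun_apply A x) x\<bar> \<le> norm (blinfun_apply A x) * norm x"
    by (rule Cauchy_Schwarz_ineq2)
  also have "\<dots> \<le> norm A * norm x * norm x"
    by (intro mult_right_mono norm_blinfun) simp
  finally show ?thesis by (simp add: power2_eq_square mult_ac)
qed

text \<open>A self-adjoint \<open>X\<close> lies between \<open>- norm X\<close> and
  \<open>norm X\<close> times the identity. Positivity carries this through the iterates, and
  \<open>norm_selfadjoint_le\<close> returns to norms.\<close>

lemma norm_kraus_funpow_le:
  assumes "adj X = X"
  shows "norm ((kraus n T ^^ s) X) \<le> norm ((kraus n T ^^ s) id_blinfun) * norm X"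
proof (rule norm_selfadjoint_le)
  fix x
  have "\<bar>inner (blinfun_apply ((kraus n T ^^ s) X) x) x\<bar>
      \<le> norm X * inner (blinfun_apply ((kraus n T ^^ s) id_blinfun) x) x"
    using abs_quadratic_form_le[of X]
    by (intro kraus_funpow_dominated) (simp add: power2_norm_eq_inner)
  also have "\<dots> \<le> norm X * (norm ((kraus n T ^^ s) id_blinfun) * (norm x)\<^sup>2)"
    by (intro mult_left_mono order_trans[OF abs_ge_self abs_quadratic_form_le]) auto
  finally show "\<bar>inner (blinfun_apply ((kraus n T ^^ s) X) x) x\<bar>
      \<le> norm ((kraus n T ^^ s) id_blinfun) * norm X * (norm x)\<^sup>2" by (simp add: mult_ac)
qed (auto simp: adj_kraus_funpow assms)

lemma norm_kraus_funpow_submult: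
  "norm ((kraus n T ^^ (s + t)) id_blinfun)
    \<le> norm ((kraus n T ^^ s) id_blinfun) * norm ((kraus n T ^^ t) id_blinfun)"
  by (simp add: funpow_add norm_kraus_funpow_le adj_kraus_funpow)

section \<open>From the spectral radius to a condition on a single iterate\<close>

lemma cp_map_eq_kraus:
  assumes "representation n \<rho>"
  shows "cp_map n \<rho> = kraus n (\<lambda>j. \<rho> [j])"
proof
  fix X
  have "\<rho> [j] \<in> BH" if "j \<in> {1..n}" for j
    using assms that by (auto simp: representation_def free_monoid_def)
  then show "cp_map n \<rho> X = kraus n (\<lambda>j. \<rho> [j]) X"
    by (simp add: cp_map_def kraus_def cadjoint_eq_adj)
qed

lemma spectral_radius_less_1_iff:
  assumes "representation n \<rho>"
  shows "spectral_radius n \<rho> < 1 \<longleftrightarrow>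
    (\<exists>s\<ge>1. norm ((kraus n (\<lambda>j. \<rho> [j]) ^^ s) id_blinfun) < 1)"
  unfolding spectral_radius_def cp_map_eq_kraus[OF assms]
  by (rule submultiplicative_lim_less_1_iff) (auto intro: norm_kraus_funpow_submult)

text \<open>A row operator has the same norm as its adjoint, the column
  \<open>y \<mapsto> (adj (T j) y)\<close>. One direction tests the row on the normalised column of
  \<open>y\<close>, the other is Cauchy-Schwarz.\<close>

lemma row_norm_le_iff:
  fixes T :: "nat \<Rightarrow> 'a::complex_hilbert_space \<Rightarrow>\<^sub>L 'a"
  assumes "c \<ge> 0"
  shows "row_norm n T \<le> c \<longleftrightarrow>
    (\<forall>y. (\<Sum>j=1..n. (norm (blinfun_apply (adj (T j)) y))\<^sup>2) \<le> c\<^sup>2 * (norm y)\<^sup>2)"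
proof
  let ?U = "{x \<in> direct_sum n. direct_sum_norm n x \<le> 1} :: (nat \<Rightarrow> 'a) set"
  have "norm (row_operator n T x) \<le> L2_set (\<lambda>j. norm (T j)) {1..n}" if "x \<in> ?U" for x
  proof -
    have "norm (row_operator n T x) \<le> (\<Sum>j=1..n. \<bar>norm (T j)\<bar> * \<bar>norm (x j)\<bar>)"
      unfolding row_operator_def by (rule order_trans[OF norm_sum]) (auto intro!: sum_mono norm_blinfun)
    also have "\<dots> \<le> L2_set (\<lambda>j. norm (T j)) {1..n} * direct_sum_norm n x"
      unfolding direct_sum_norm_def by (rule L2_set_mult_ineq)
    also have "\<dots> \<le> L2_set (\<lambda>j. norm (T j)) {1..n}"
      using that by (intro mult_left_le) auto
    finally show ?thesis .
  qed
  \<comment> \<open>The supremum over a set of reals is only meaningful once the set is bounded;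
    \<open>cSUP_upper\<close> relies on this.\<close>
  then have bdd: "bdd_above ((\<lambda>x. norm (row_operator n T x)) ` ?U)" by (auto intro!: bdd_aboveI2)
  show "\<forall>y. (\<Sum>j=1..n. (norm (blinfun_apply (adj (T j)) y))\<^sup>2) \<le> c\<^sup>2 * (norm y)\<^sup>2" if le: "row_norm n T \<le> c"
  proof
    fix y
    define S where "S = (\<Sum>j=1..n. (norm (blinfun_apply (adj (T j)) y))\<^sup>2)"
    have "S \<ge> 0" by (simp add: S_def sum_nonneg)
    have "sqrt S \<le> c * norm y"
    proof (cases "S = 0")
      case False
      then have "S > 0" using \<open>S \<ge> 0\<close> by simp
      \<comment> \<open>The column of \<open>y\<close> scaled to unit length: paired with
        \<open>y\<close>, its image under the row gives exactly \<open>sqrt S\<close>.\<close>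
      define x where "x = (\<lambda>j\<in>{1..n}. blinfun_apply (adj (T j)) y /\<^sub>R sqrt S)"
      have "direct_sum_norm n x = sqrt ((\<Sum>j=1..n. (norm (blinfun_apply (adj (T j)) y))\<^sup>2 / S))"
        using \<open>S > 0\<close> unfolding direct_sum_norm_def L2_set_def
        by (intro arg_cong[where f = sqrt] sum.cong)
          (auto simp: x_def power_mult_distrib power_divide field_simps)
      also have "\<dots> = sqrt (S / S)" by (simp only: S_def sum_divide_distrib)
      also have "\<dots> = 1" using \<open>S > 0\<close> by simp
      finally have "x \<in> ?U" by (auto simp: direct_sum_def x_def)
      then have "norm (row_operator n T x) \<le> row_norm n T"
        unfolding row_norm_def by (rule cSUP_upper[OF _ bdd])
      then have x: "norm (row_operator n T x) \<le> c" using le by simp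
      have "inner (row_operator n T x) y = (\<Sum>j=1..n. (norm (blinfun_apply (adj (T j)) y))\<^sup>2 / sqrt S)"
        unfolding row_operator_def inner_sum_left
        by (intro sum.cong) (auto simp: x_def blinfun.scaleR_right inner_adj power2_norm_eq_inner field_simps)
      also have "\<dots> = S / sqrt S" by (simp only: S_def sum_divide_distrib)
      also have "\<dots> = sqrt S" using \<open>S \<ge> 0\<close> by (rule real_div_sqrt)
      finally have "sqrt S \<le> norm (row_operator n T x) * norm y"
        by (metis norm_cauchy_schwarz)
      also have "\<dots> \<le> c * norm y" using x by (intro mult_right_mono) auto
      finally show ?thesis .
    qed (use \<open>c \<ge> 0\<close> in auto)
    then show "S \<le> c\<^sup>2 * (norm y)\<^sup>2"
      using \<open>S \<ge> 0\<close> by (simp add: real_sqrt_le_iff sqrt_le_D flip: power_mult_distrib)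
  qed
  show "row_norm n T \<le> c"
    if le: "\<forall>y. (\<Sum>j=1..n. (norm (blinfun_apply (adj (T j)) y))\<^sup>2) \<le> c\<^sup>2 * (norm y)\<^sup>2"
    unfolding row_norm_def
  proof (rule cSUP_least)
    have "(\<lambda>j\<in>{1..n}. 0) \<in> ?U"
      by (auto simp: direct_sum_def direct_sum_norm_def L2_set_def)
    then show "?U \<noteq> {}" by blast
    fix x :: "nat \<Rightarrow> 'a" assume x: "x \<in> ?U"
    define y where "y = row_operator n T x"
    have "norm y * norm y = inner (row_operator n T x) y"
      by (simp add: y_def power2_norm_eq_inner flip: power2_eq_square)
    also have "\<dots> = (\<Sum>j=1..n. inner (x j) (blinfun_apply (adj (T j)) y))"
      by (simp add: row_operator_def inner_sum_left inner_adj)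
    also have "\<dots> \<le> (\<Sum>j=1..n. \<bar>norm (x j)\<bar> * \<bar>norm (blinfun_apply (adj (T j)) y)\<bar>)"
      by (intro sum_mono) (simp add: norm_cauchy_schwarz)
    also have "\<dots> \<le> L2_set (\<lambda>j. norm (x j)) {1..n} * L2_set (\<lambda>j. norm (blinfun_apply (adj (T j)) y)) {1..n}"
      by (rule L2_set_mult_ineq)
    also have "\<dots> \<le> 1 * (c * norm y)"
    proof (intro mult_mono)
      show "L2_set (\<lambda>j. norm (x j)) {1..n} \<le> 1" using x by (simp add: direct_sum_norm_def)
      show "L2_set (\<lambda>j. norm (blinfun_apply (adj (T j)) y)) {1..n} \<le> c * norm y"
        unfolding L2_set_def using le \<open>c \<ge> 0\<close>
        by (intro real_le_lsqrt) (auto simp: power_mult_distrib sum_nonneg)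
    qed auto
    finally have "norm y * norm y \<le> c * norm y" by simp
    then show "norm (row_operator n T x) \<le> c"
      using \<open>c \<ge> 0\<close> by (cases "norm y = 0") (auto simp: y_def)
  qed
qed

section \<open>Joint similarity\<close>

text \<open>The contraction becomes geometric decay of the iterates on \<open>Q = Y Y*\<close>;
  since \<open>Q\<close> dominates a multiple of the identity, the iterates at the identity decay as
  well.\<close>

lemma kraus_power_lt_1_of_row_contraction:
  fixes T :: "nat \<Rightarrow> 'a::complex_hilbert_space \<Rightarrow>\<^sub>L 'a"
  assumes inv: "is_inverse Y Z" and lt: "row_norm n (\<lambda>j. Z o\<^sub>L T j o\<^sub>L Y) < 1"
  shows "\<exists>s\<ge>1. norm ((kraus n T ^^ s) id_blinfun) < 1"
proof -
  \<comment> \<open>The maximum with 0 meets the sign condition of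
    \<open>row_norm_le_iff\<close>.\<close>
  define c where "c = max (row_norm n (\<lambda>j. Z o\<^sub>L T j o\<^sub>L Y)) 0"
  have c: "0 \<le> c" "c < 1" "row_norm n (\<lambda>j. Z o\<^sub>L T j o\<^sub>L Y) \<le> c" using lt by (auto simp: c_def)
  define Q where "Q = Y o\<^sub>L adj Y"
  have Q: "inner (blinfun_apply Q x) x = (norm (blinfun_apply (adj Y) x))\<^sup>2" for x
    by (simp add: Q_def inner_adj power2_norm_eq_inner)
  have "adj Z o\<^sub>L adj Y = id_blinfun"
    using inv by (metis adj_compose adj_id is_inverse_def)
  then have ZY: "blinfun_apply (adj Z) (blinfun_apply (adj Y) x) = x" for x
    by (metis blinfun_apply_blinfun_compose blinfun_apply_id_blinfun id_apply)
  \<comment> \<open>The row bound is evaluated at \<open>adj Y x\<close>, where the factor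
    \<open>adj Z\<close> in the adjoint of \<open>Z T j Y\<close> cancels against
    \<open>adj Y\<close>.\<close>
  have step: "inner (blinfun_apply (kraus n T Q) x) x \<le> c\<^sup>2 * inner (blinfun_apply Q x) x" for x
    using c(3)[unfolded row_norm_le_iff[OF c(1)], rule_format, of "blinfun_apply (adj Y) x"]
    by (simp add: inner_kraus Q adj_compose ZY)
  have nn: "0 \<le> inner (blinfun_apply ((kraus n T ^^ s) Q) x) x" for s x
    by (rule kraus_funpow_nonneg) (simp add: Q)
  have Qs: "inner (blinfun_apply ((kraus n T ^^ s) Q) x) x \<le> (c\<^sup>2) ^ s * inner (blinfun_apply Q x) x" for s x
  proof (induction s arbitrary: x)
    case (Suc s)
    have "inner (blinfun_apply ((kraus n T ^^ Suc s) Q) x) x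
        \<le> (c\<^sup>2) ^ s * inner (blinfun_apply (kraus n T Q) x) x"
      using kraus_dominated[where X = "(kraus n T ^^ s) Q" and r = "(c\<^sup>2) ^ s" and Q = Q
          and n = n and T = T and x = x] Suc nn[of s] by force
    also have "\<dots> \<le> (c\<^sup>2) ^ s * (c\<^sup>2 * inner (blinfun_apply Q x) x)"
      by (intro mult_left_mono step) simp
    finally show ?case by (simp add: mult_ac)
  qed simp
  define K where "K = (norm (adj Z))\<^sup>2 * norm Q"
  have I_le: "\<bar>inner (blinfun_apply id_blinfun x) x\<bar> \<le> (norm (adj Z))\<^sup>2 * inner (blinfun_apply Q x) x" for x
  proof -
    have "norm x \<le> norm (adj Z) * norm (blinfun_apply (adj Y) x)"
      by (metis ZY norm_blinfun)
    then have "(norm x)\<^sup>2 \<le> (norm (adj Z) * norm (blinfun_apply (adj Y) x))\<^sup>2"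
      by (intro power_mono) auto
    then show ?thesis by (simp add: Q power_mult_distrib power2_norm_eq_inner)
  qed
  have bound: "norm ((kraus n T ^^ s) id_blinfun) \<le> K * (c\<^sup>2) ^ s" for s
  proof (rule norm_selfadjoint_le)
    fix x
    have "\<bar>inner (blinfun_apply ((kraus n T ^^ s) id_blinfun) x) x\<bar>
        \<le> (norm (adj Z))\<^sup>2 * inner (blinfun_apply ((kraus n T ^^ s) Q) x) x"
      by (intro kraus_funpow_dominated I_le)
    also have "\<dots> \<le> (norm (adj Z))\<^sup>2 * ((c\<^sup>2) ^ s * (norm Q * (norm x)\<^sup>2))"
      by (intro mult_left_mono order_trans[OF Qs] order_trans[OF abs_ge_self abs_quadratic_form_le]) auto
    finally show "\<bar>inner (blinfun_apply ((kraus n T ^^ s) id_blinfun) x) x\<bar> \<le> K * (c\<^sup>2) ^ s * (norm x)\<^sup>2"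
      by (simp add: K_def mult_ac)
  qed (auto simp: adj_kraus_funpow K_def)
  have "c\<^sup>2 < 1" using c by (simp add: power_less_one_iff)
  then have "(\<lambda>s. K * (c\<^sup>2) ^ s) \<longlonglongrightarrow> K * 0"
    by (intro tendsto_intros LIMSEQ_power_zero) simp
  then have "\<forall>\<^sub>F s in sequentially. K * (c\<^sup>2) ^ s < 1" by (rule order_tendstoD) simp
  then have "\<forall>\<^sub>F s in sequentially. s \<ge> 1 \<and> K * (c\<^sup>2) ^ s < 1"
    using eventually_ge_at_top[of 1] by eventually_elim simp
  then obtain s where "s \<ge> 1" "K * (c\<^sup>2) ^ s < 1"
    using eventually_happens'[OF sequentially_bot] by blast
  then show ?thesis using bound[of s] by (intro exI[of _ s]) simp
qed

text \<open>Submultiplicativity gives geometric decay along the positive multiples of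
  \<open>s\<close>; the fixed factor \<open>r\<close> is later \<open>norm P\<close>.\<close>

lemma kraus_funpow_arbitrarily_small:
  assumes "s \<ge> 1" and lt: "norm ((kraus n T ^^ s) id_blinfun) < 1" and "e > 0"
  obtains m where "m \<ge> 1" "norm ((kraus n T ^^ m) id_blinfun) * r < e"
proof -
  let ?a = "\<lambda>s. norm ((kraus n T ^^ s) id_blinfun)"
  have pow: "?a (s * Suc q) \<le> ?a s ^ Suc q" for q
  proof (induction q)
    case (Suc q)
    have "?a (s * Suc (Suc q)) \<le> ?a s * ?a (s * Suc q)"
      using norm_kraus_funpow_submult[where s = s and t = "s * Suc q"] by simp
    also have "\<dots> \<le> ?a s * ?a s ^ Suc q" by (intro mult_left_mono Suc) simp
    finally show ?case by simp
  qed simp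
  have "(\<lambda>q. ?a s ^ Suc q * \<bar>r\<bar>) \<longlonglongrightarrow> 0 * \<bar>r\<bar>"
    using lt by (intro tendsto_intros LIMSEQ_Suc[OF LIMSEQ_power_zero]) simp
  then have "\<forall>\<^sub>F q in sequentially. ?a s ^ Suc q * \<bar>r\<bar> < e"
    using \<open>e > 0\<close> by (intro order_tendstoD) simp_all
  then obtain q where q: "?a s ^ Suc q * \<bar>r\<bar> < e"
    using eventually_happens'[OF sequentially_bot] by blast
  have "?a (s * Suc q) * r \<le> ?a (s * Suc q) * \<bar>r\<bar>" by (intro mult_left_mono) auto
  also have "\<dots> \<le> ?a s ^ Suc q * \<bar>r\<bar>" by (intro mult_right_mono pow) auto
  also note q
  finally show ?thesis using that[of "s * Suc q"] \<open>s \<ge> 1\<close> by simp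
qed

text \<open>Adding one index \<open>i\<close> replaces \<open>P\<close> by \<open>P' = \<Sum>t<m. \<Phi>\<^sub>i\<^sup>t P\<close>. Then
  \<open>P' - \<Phi>\<^sub>i P' = P - \<Phi>\<^sub>i\<^sup>m P\<close> by telescoping, and for the old indices
  \<open>P' - \<Phi>\<^sub>j P' = \<Sum>t<m. \<Phi>\<^sub>i\<^sup>t (P - \<Phi>\<^sub>j P)\<close> because the maps commute; no infinite
  series is needed.\<close>

lemma common_strict_supersolution:
  fixes T :: "nat \<Rightarrow> nat \<Rightarrow> 'a::complex_hilbert_space \<Rightarrow>\<^sub>L 'a"
  assumes "finite I"
    and "\<And>i j. i \<in> I \<Longrightarrow> j \<in> {1..n i} \<Longrightarrow> T i j \<in> BH"
    and "\<And>i i' a b. i \<in> I \<Longrightarrow> i' \<in> I \<Longrightarrow> i \<noteq> i' \<Longrightarrow> a \<in> {1..n i} \<Longrightarrow> b \<in> {1..n i'} \<Longrightarrow>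
      T i a o\<^sub>L T i' b = T i' b o\<^sub>L T i a"
    and "\<And>i. i \<in> I \<Longrightarrow> \<exists>s\<ge>1. norm ((kraus (n i) (T i) ^^ s) id_blinfun) < 1"
  shows "\<exists>P \<delta>. P \<in> BH \<and> adj P = P \<and> (\<forall>x. (norm x)\<^sup>2 \<le> inner (blinfun_apply P x) x) \<and> \<delta> > 0 \<and>
    (\<forall>i\<in>I. \<forall>x. inner (blinfun_apply (kraus (n i) (T i) P) x) x + \<delta> * (norm x)\<^sup>2
      \<le> inner (blinfun_apply P x) x)"
  using assms
proof (induction I rule: finite_induct)
  case empty
  show ?case
    by (intro exI[of _ id_blinfun] exI[of _ 1]) (simp add: id_BH power2_norm_eq_inner)
next
  case (insert i I)
  have "\<exists>P \<delta>. P \<in> BH \<and> adj P = P \<and> (\<forall>x. (norm x)\<^sup>2 \<le> inner (blinfun_apply P x) x) \<and> \<delta> > 0 \<and>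
    (\<forall>i\<in>I. \<forall>x. inner (blinfun_apply (kraus (n i) (T i) P) x) x + \<delta> * (norm x)\<^sup>2
      \<le> inner (blinfun_apply P x) x)"
    using insert.prems by (intro insert.IH) auto
  then obtain P \<delta> where P: "P \<in> BH" "adj P = P" and ge: "\<And>x. (norm x)\<^sup>2 \<le> inner (blinfun_apply P x) x"
    and "\<delta> > 0"
    and old: "\<And>j x. j \<in> I \<Longrightarrow> inner (blinfun_apply (kraus (n j) (T j) P) x) x + \<delta> * (norm x)\<^sup>2
      \<le> inner (blinfun_apply P x) x"
    by blast
  define \<Phi> where "\<Phi> j = kraus (n j) (T j)" for j
  obtain s where "s \<ge> 1" "norm ((\<Phi> i ^^ s) id_blinfun) < 1"
    using insert.prems(3) unfolding \<Phi>_def by blast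
  \<comment> \<open>With this \<open>m\<close> the remainder of the telescoping sum is at most
    \<open>I / 2\<close>, which leaves \<open>I / 2\<close> of the bound
    \<open>P \<ge> I\<close>.\<close>
  then obtain m where "m \<ge> 1" and m: "norm ((\<Phi> i ^^ m) id_blinfun) * norm P < 1/2"
    using kraus_funpow_arbitrarily_small[of s "n i" "T i" "1/2" "norm P"] unfolding \<Phi>_def by auto
  have sum_ge_first: "f 0 \<le> (\<Sum>t<m. f t)" if "\<And>t. 0 \<le> f t" for f :: "nat \<Rightarrow> real"
    using \<open>m \<ge> 1\<close> that by (intro member_le_sum) auto
  define P' where "P' = (\<Sum>t<m. (\<Phi> i ^^ t) P)"
  have P'_apply: "inner (blinfun_apply P' x) x = (\<Sum>t<m. inner (blinfun_apply ((\<Phi> i ^^ t) P) x) x)" for x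
    by (simp add: P'_def blinfun.sum_left inner_sum_left)
  have BH: "P' \<in> BH" unfolding P'_def \<Phi>_def
    using insert.prems(1) P by (intro sum_BH kraus_funpow_BH) auto
  have sa: "adj P' = P'"
    by (simp add: P'_def \<Phi>_def adj_sum adj_kraus_funpow P)
  have ge': "(norm x)\<^sup>2 \<le> inner (blinfun_apply P' x) x" for x
  proof -
    have "0 \<le> inner (blinfun_apply P y) y" for y using ge[of y] order_trans zero_le_power2 by blast
    then have "inner (blinfun_apply ((\<Phi> i ^^ 0) P) x) x \<le> inner (blinfun_apply P' x) x"
      unfolding P'_apply \<Phi>_def by (intro sum_ge_first kraus_funpow_nonneg)
    then show ?thesis using ge[of x] by simp
  qed
  have new_i: "inner (blinfun_apply (\<Phi> i P') x) x + (1/2) * (norm x)\<^sup>2 \<le> inner (blinfun_apply P' x) x" for x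
  proof -
    have "P' - \<Phi> i P' = (\<Sum>t<m. (\<Phi> i ^^ t) P - (\<Phi> i ^^ Suc t) P)"
      by (simp add: P'_def \<Phi>_def kraus_sum sum_subtractf)
    also have "\<dots> = P - (\<Phi> i ^^ m) P"
      using sum_lessThan_telescope'[of "\<lambda>t. (\<Phi> i ^^ t) P" m] by simp
    finally have "inner (blinfun_apply (P' - \<Phi> i P') x) x = inner (blinfun_apply (P - (\<Phi> i ^^ m) P) x) x"
      by simp
    moreover have "inner (blinfun_apply ((\<Phi> i ^^ m) P) x) x \<le> (1/2) * (norm x)\<^sup>2"
    proof -
      have "norm ((\<Phi> i ^^ m) P) \<le> norm ((\<Phi> i ^^ m) id_blinfun) * norm P"
        unfolding \<Phi>_def by (rule norm_kraus_funpow_le) (rule P)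
      then have "norm ((\<Phi> i ^^ m) P) \<le> 1/2" using m by linarith
      then have "norm ((\<Phi> i ^^ m) P) * (norm x)\<^sup>2 \<le> (1/2) * (norm x)\<^sup>2"
        by (intro mult_right_mono) auto
      then show ?thesis using abs_quadratic_form_le[of "(\<Phi> i ^^ m) P" x] by linarith
    qed
    ultimately show ?thesis using ge[of x] by (simp add: blinfun.diff_left inner_diff_left)
  qed
  have new_j: "inner (blinfun_apply (\<Phi> j P') x) x + \<delta> * (norm x)\<^sup>2 \<le> inner (blinfun_apply P' x) x"
    if "j \<in> I" for j x
  proof -
    \<comment> \<open>The iterates keep \<open>D\<close> positive, so dropping all summands but
      \<open>t = 0\<close> leaves \<open>D\<close> itself, and the old gap \<open>\<delta>\<close>
      survives.\<close>
    define D where "D = P - \<Phi> j P"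
    have D: "\<delta> * (norm y)\<^sup>2 \<le> inner (blinfun_apply D y) y" for y
      using old[OF that, of y] by (simp add: D_def \<Phi>_def blinfun.diff_left inner_diff_left)
    then have D0: "0 \<le> inner (blinfun_apply D y) y" for y
      using \<open>\<delta> > 0\<close> by (meson order_trans zero_le_mult_iff zero_le_power2 less_imp_le)
    have comm: "\<Phi> j ((\<Phi> i ^^ t) P) = (\<Phi> i ^^ t) (\<Phi> j P)" for t
      unfolding \<Phi>_def using that insert.hyps by (intro kraus_funpow_commute insert.prems(2)) auto
    have "P' - \<Phi> j P' = (\<Sum>t<m. (\<Phi> i ^^ t) P - \<Phi> j ((\<Phi> i ^^ t) P))"
      by (simp add: P'_def \<Phi>_def kraus_sum sum_subtractf)
    also have "\<dots> = (\<Sum>t<m. (\<Phi> i ^^ t) D)"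
      unfolding comm D_def by (simp add: \<Phi>_def kraus_funpow_diff)
    finally have "inner (blinfun_apply (P' - \<Phi> j P') x) x = (\<Sum>t<m. inner (blinfun_apply ((\<Phi> i ^^ t) D) x) x)"
      by (simp add: blinfun.sum_left inner_sum_left)
    moreover have "inner (blinfun_apply ((\<Phi> i ^^ 0) D) x) x \<le> \<dots>"
      unfolding \<Phi>_def by (intro sum_ge_first kraus_funpow_nonneg D0)
    ultimately show ?thesis using D[of x] by (simp add: blinfun.diff_left inner_diff_left)
  qed
  have all: "inner (blinfun_apply (\<Phi> j P') x) x + min \<delta> (1/2) * (norm x)\<^sup>2
      \<le> inner (blinfun_apply P' x) x" if "j \<in> insert i I" for j x
  proof -
    have "min \<delta> (1/2) * (norm x)\<^sup>2 \<le> \<delta> * (norm x)\<^sup>2"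
      "min \<delta> (1/2) * (norm x)\<^sup>2 \<le> (1/2) * (norm x)\<^sup>2"
      by (intro mult_right_mono; simp)+
    then show ?thesis using that new_i[of x] new_j[of j x] by (cases "j = i") auto
  qed
  have pos: "min \<delta> (1/2) > 0" using \<open>\<delta> > 0\<close> by simp
  show ?case
    by (intro exI[of _ P'] exI[of _ "min \<delta> (1/2)"] conjI allI ballI BH sa ge' pos all[unfolded \<Phi>_def])
qed

text \<open>At \<open>u = adj Z y\<close> the form of \<open>Y Y*\<close> is the squared norm of
  \<open>y\<close>, and that of its image is the sum bounding the row norm. The gap
  \<open>\<delta>\<close> at \<open>u\<close> becomes a fraction \<open>\<delta> / M\<close> of the
  squared norm of \<open>y\<close>, because \<open>Y Y* \<le> M I\<close>.\<close>

lemma similar_row_contraction: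
  fixes T :: "nat \<Rightarrow> 'a::complex_hilbert_space \<Rightarrow>\<^sub>L 'a"
  assumes inv: "is_inverse Y Z" and "\<delta> > 0"
    and le: "\<And>x. inner (blinfun_apply (kraus n T (Y o\<^sub>L adj Y)) x) x + \<delta> * (norm x)\<^sup>2
      \<le> inner (blinfun_apply (Y o\<^sub>L adj Y) x) x"
  shows "row_norm n (\<lambda>j. Z o\<^sub>L T j o\<^sub>L Y) < 1"
proof -
  \<comment> \<open>Taking the maximum with \<open>\<delta>\<close> keeps \<open>M\<close> positive
    and \<open>1 - \<delta> / M\<close> nonnegative even on the zero space, where the operator norm
    is 0.\<close>
  define M where "M = max (norm (Y o\<^sub>L adj Y)) \<delta>"
  have M: "M \<ge> \<delta>" "M > 0" "norm (Y o\<^sub>L adj Y) \<le> M" using \<open>\<delta> > 0\<close> by (auto simp: M_def)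
  define c where "c = sqrt (1 - \<delta> / M)"
  have c: "0 \<le> c" "c < 1" "c\<^sup>2 = 1 - \<delta> / M" using M \<open>\<delta> > 0\<close> by (auto simp: c_def)
  have "adj Y o\<^sub>L adj Z = id_blinfun"
    using inv by (metis adj_compose adj_id is_inverse_def)
  then have YZ: "blinfun_apply (adj Y) (blinfun_apply (adj Z) x) = x" for x
    by (metis blinfun_apply_blinfun_compose blinfun_apply_id_blinfun id_apply)
  have "(\<Sum>j=1..n. (norm (blinfun_apply (adj (Z o\<^sub>L T j o\<^sub>L Y)) y))\<^sup>2) \<le> c\<^sup>2 * (norm y)\<^sup>2" for y
  proof -
    define u where "u = blinfun_apply (adj Z) y"
    have P: "inner (blinfun_apply (Y o\<^sub>L adj Y) u) u = (norm y)\<^sup>2"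
      by (simp add: inner_adj u_def YZ power2_norm_eq_inner)
    have "(norm y)\<^sup>2 \<le> M * (norm u)\<^sup>2"
      using abs_quadratic_form_le[of "Y o\<^sub>L adj Y" u] mult_right_mono[OF M(3), of "(norm u)\<^sup>2"]
      unfolding P by simp
    then have "\<delta> / M * (norm y)\<^sup>2 \<le> \<delta> / M * (M * (norm u)\<^sup>2)"
      using \<open>\<delta> > 0\<close> M by (intro mult_left_mono) auto
    then have "\<delta> / M * (norm y)\<^sup>2 \<le> \<delta> * (norm u)\<^sup>2" using M by simp
    moreover have "(\<Sum>j=1..n. (norm (blinfun_apply (adj (Z o\<^sub>L T j o\<^sub>L Y)) y))\<^sup>2)
        = inner (blinfun_apply (kraus n T (Y o\<^sub>L adj Y)) u) u"
      unfolding inner_kraus by (simp add: adj_compose inner_adj u_def power2_norm_eq_inner)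
    moreover note le[of u, unfolded P]
    ultimately show ?thesis unfolding c(3) left_diff_distrib by linarith
  qed
  then have "row_norm n (\<lambda>j. Z o\<^sub>L T j o\<^sub>L Y) \<le> c"
    unfolding row_norm_le_iff[OF c(1)] by blast
  then show ?thesis using c by simp
qed

section \<open>Conjugation of representations and of their direct product\<close>

lemma representation_similar:
  assumes "representation n \<rho>" "Y \<in> BH" "Z \<in> BH" "is_inverse Y Z"
  shows "representation n (\<lambda>w. Z o\<^sub>L \<rho> w o\<^sub>L Y)"
proof -
  have cancel: "Y o\<^sub>L (Z o\<^sub>L A) = A" "Z o\<^sub>L Y = id_blinfun" for A
    using assms(4) unfolding is_inverse_def
    by (simp_all add: blinfun_compose_algebra(9) flip: blinfun_compose_algebra(11))
  show ?thesis
    using assms(1-3) unfolding representation_def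
    by (auto simp: image_subset_iff compose_BH blinfun_compose_algebra(9-11) cancel)
qed

text \<open>The inner factors \<open>Y Z\<close> cancel between neighbours; for the empty product
  what remains is \<open>Z Y\<close>, the identity.\<close>

lemma direct_product_similar:
  assumes "is_inverse Y Z"
  shows "Z o\<^sub>L direct_product k \<rho> \<alpha> o\<^sub>L Y = direct_product k (\<lambda>i w. Z o\<^sub>L \<rho> i w o\<^sub>L Y) \<alpha>"
proof -
  have cancel: "Y o\<^sub>L (Z o\<^sub>L A) = A" "Z o\<^sub>L Y = id_blinfun" for A
    using assms unfolding is_inverse_def
    by (simp_all add: blinfun_compose_algebra(9) flip: blinfun_compose_algebra(11))
  have "Z o\<^sub>L foldr (o\<^sub>L) (map (\<lambda>i. \<rho> i (\<alpha> i)) is) id_blinfun o\<^sub>L Y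
    = foldr (o\<^sub>L) (map (\<lambda>i. Z o\<^sub>L \<rho> i (\<alpha> i) o\<^sub>L Y) is) id_blinfun" for "is"
  proof (induction "is")
    case (Cons i js)
    from Cons.IH[symmetric] show ?case
      by (simp add: blinfun_compose_algebra(11) cancel)
  qed (simp add: blinfun_compose_algebra(10) cancel)
  then show ?thesis by (simp add: direct_product_def)
qed

theorem corollary3p10:
  fixes k :: nat
    and n :: "nat \<Rightarrow> nat"
    and \<pi> :: "nat \<Rightarrow> nat list \<Rightarrow> 'a::complex_hilbert_space \<Rightarrow>\<^sub>L 'a"
    and \<sigma> :: "(nat \<Rightarrow> nat list) \<Rightarrow> 'a \<Rightarrow>\<^sub>L 'a"
  assumes "separable_hilbert TYPE('a)"
    and "k \<ge> 1"
    and "\<And>i. i \<in> {1..k} \<Longrightarrow> n i \<ge> 1"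
    and "\<And>i. i \<in> {1..k} \<Longrightarrow> representation (n i) (\<pi> i)"
    and "commuting_ranges k n \<pi>"
    and "\<And>\<alpha>. \<alpha> \<in> product_monoid k n \<Longrightarrow> \<sigma> \<alpha> = direct_product k \<pi> \<alpha>"
  shows "(\<exists>Y\<in>BH. \<exists>Z\<in>BH. is_inverse Y Z \<and>
            (\<forall>i\<in>{1..k}.
               representation (n i) (\<lambda>w. Z o\<^sub>L \<pi> i w o\<^sub>L Y) \<and>
               strictly_row_contractive (n i) (\<lambda>w. Z o\<^sub>L \<pi> i w o\<^sub>L Y)) \<and>
            (\<forall>\<alpha>\<in>product_monoid k n.
               Z o\<^sub>L \<sigma> \<alpha> o\<^sub>L Y = direct_product k (\<lambda>i w. Z o\<^sub>L \<pi> i w o\<^sub>L Y) \<alpha>)) \<longleftrightarrow>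
         (\<forall>i\<in>{1..k}. spectral_radius (n i) (\<pi> i) < 1)"
    (is "?similar \<longleftrightarrow> ?radius")
proof
  note rep = assms(4)
  show ?radius if ?similar
    using that kraus_power_lt_1_of_row_contraction
    unfolding strictly_row_contractive_def by (fastforce simp: spectral_radius_less_1_iff rep)
  show ?similar if ?radius
  proof -
    let ?T = "\<lambda>i j. \<pi> i [j]"
    have letter: "[j] \<in> free_monoid (n i)" if "j \<in> {1..n i}" for i j
      using that by (simp add: free_monoid_def)
    have "\<exists>P \<delta>. P \<in> BH \<and> adj P = P \<and> (\<forall>x. (norm x)\<^sup>2 \<le> inner (blinfun_apply P x) x) \<and> \<delta> > 0 \<and>
      (\<forall>i\<in>{1..k}. \<forall>x. inner (blinfun_apply (kraus (n i) (?T i) P) x) x + \<delta> * (norm x)\<^sup>2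
        \<le> inner (blinfun_apply P x) x)"
    proof (rule common_strict_supersolution)
      show "\<pi> i [j] \<in> BH" if "i \<in> {1..k}" "j \<in> {1..n i}" for i j
        using rep[OF that(1)] letter[OF that(2)] by (auto simp: representation_def)
      show "\<pi> i [a] o\<^sub>L \<pi> j [b] = \<pi> j [b] o\<^sub>L \<pi> i [a]"
        if "i \<in> {1..k}" "j \<in> {1..k}" "i \<noteq> j" "a \<in> {1..n i}" "b \<in> {1..n j}" for i j a b
        using assms(5) that letter unfolding commuting_ranges_def by blast
      show "\<exists>s\<ge>1. norm ((kraus (n i) (?T i) ^^ s) id_blinfun) < 1" if "i \<in> {1..k}" for i
        using \<open>?radius\<close> that rep by (simp add: spectral_radius_less_1_iff)
    qed simp
    then obtain P \<delta> where P: "P \<in> BH" "adj P = P" "\<And>x. (norm x)\<^sup>2 \<le> inner (blinfun_apply P x) x" "\<delta> > 0"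
      and le: "\<And>i x. i \<in> {1..k} \<Longrightarrow> inner (blinfun_apply (kraus (n i) (?T i) P) x) x + \<delta> * (norm x)\<^sup>2
        \<le> inner (blinfun_apply P x) x"
      by blast
    \<comment> \<open>Since \<open>P\<close> does not depend on \<open>i\<close>, this one
      \<open>Y\<close> serves all the representations simultaneously.\<close>
    obtain Y Z where YZ: "Y \<in> BH" "Z \<in> BH" "is_inverse Y Z" "Y o\<^sub>L adj Y = P"
      using positive_definite_sqrt[OF P(1-3)] .
    show ?thesis
    proof (rule bexI[of _ Y], rule bexI[of _ Z], intro conjI ballI)
      show "is_inverse Y Z" by (rule YZ)
      fix i assume i: "i \<in> {1..k}"
      show "representation (n i) (\<lambda>w. Z o\<^sub>L \<pi> i w o\<^sub>L Y)"
        by (intro representation_similar rep i YZ)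
      show "strictly_row_contractive (n i) (\<lambda>w. Z o\<^sub>L \<pi> i w o\<^sub>L Y)"
        unfolding strictly_row_contractive_def
        by (rule similar_row_contraction[OF YZ(3) P(4)]) (use le[OF i] YZ(4) in simp)
    next
      fix \<alpha> assume "\<alpha> \<in> product_monoid k n"
      then show "Z o\<^sub>L \<sigma> \<alpha> o\<^sub>L Y = direct_product k (\<lambda>i w. Z o\<^sub>L \<pi> i w o\<^sub>L Y) \<alpha>"
        by (simp only: assms(6) direct_product_similar[OF YZ(3)])
    qed (fact YZ)+
  qed
qed

end
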